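(* Let $H$ be a complex Hilbert space with $\dim(H)\ge 2$, let $\mathbf{G}\subseteq H$ be non-empty, and let $\Theta,\Theta'\subseteq\mathbb{T}$ satisfy $|\Theta|=|\Theta'|=4$. Suppose that there are enumerations $\Theta=\{\theta_1,\theta_2,\theta_3,\theta_4\}$ and $\Theta'=\{\theta_1',\theta_2',\theta_3',\theta_4'\}$ such that $\mathrm{CR}(\theta_1,\theta_2;\theta_3,\theta_4)=\mathrm{CR}(\theta_1',\theta_2';\theta_3',\theta_4')$. Then $\mathbf{G}$ does $\Theta$-PR if and only if $\mathbf{G}$ does $\Theta'$-PR.
   Context: $\mathbb{T}=\{z\in\mathbb{C}:|z|=1\}$. The inner product $\langle\cdot,\cdot\rangle$ is linear in the first and conjugate linear in the second argument. For $\Theta\subseteq\mathbb{T}$, a set $\mathbf{G}\subseteq H$ does $\Theta$-PR (in $H$) if for all $f,h\in H$ the following holds: if for every $g\in\mathbf{G}$ there exists $\theta_g\in\Theta$ with $\langle f,g\rangle=\theta_g\langle h,g\rangle$, then $f=\theta h$ for some $\theta\in\Theta$. For pairwise distinct $z_1,z_2,z_3,z_4\in\mathbb{C}$ the cross ratio is $\mathrm{CR}(z_1,z_2;z_3,z_4)=\frac{(z_1-z_3)(z_2-z_4)}{(z_1-z_4)(z_2-z_3)}$. *)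

theory Defs
  imports "HOL-Analysis.Analysis" "HOL-Library.Extended_Nat"
begin

text \<open>
  The inner product is linear in the first and conjugate linear in the second argument.
  Norm, metric and completeness are those of the underlying real structure.
\<close>

class complex_inner = real_normed_vector +
  fixes scaleC :: "complex \<Rightarrow> 'a \<Rightarrow> 'a"  (infixr \<open>*\<^sub>C\<close> 75)
    and cinner :: "'a \<Rightarrow> 'a \<Rightarrow> complex"
  assumes scaleC_add_right: "a *\<^sub>C (x + y) = a *\<^sub>C x + a *\<^sub>C y"
    and scaleC_add_left: "(a + b) *\<^sub>C x = a *\<^sub>C x + b *\<^sub>C x"
    and scaleC_scaleC: "a *\<^sub>C (b *\<^sub>C x) = (a * b) *\<^sub>C x"
    and scaleC_one: "1 *\<^sub>C x = x"
    and scaleR_scaleC: "scaleR r x = complex_of_real r *\<^sub>C x"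
    and cinner_add_left: "cinner (x + y) z = cinner x z + cinner y z"
    and cinner_scaleC_left: "cinner (a *\<^sub>C x) y = a * cinner x y"
    and cinner_commute: "cinner x y = cnj (cinner y x)"
    and cinner_norm: "cinner x x = complex_of_real ((norm x)\<^sup>2)"

class complex_hilbert_space = complex_inner + complete_space

global_interpretation complex_vector:
  vector_space "scaleC :: complex \<Rightarrow> 'a \<Rightarrow> 'a::complex_inner"
  by unfold_locales
     (simp_all add: scaleC_add_right scaleC_add_left scaleC_scaleC scaleC_one)

text \<open>
  The library's dimension is 0 for spaces without a finite basis, hence the case distinction.
  All infinite dimensions are identified with \<open>\<infinity>\<close>.
\<close>

definition cdim :: "'a::complex_inner itself \<Rightarrow> enat" where
  "cdim _ = (if \<exists>B :: 'a set. finite B \<and> complex_vector.span B = UNIV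
             then enat (complex_vector.dim (UNIV :: 'a set)) else \<infinity>)"

definition does_PR :: "complex set \<Rightarrow> 'a::complex_inner set \<Rightarrow> bool" where
  "does_PR \<Theta> G \<longleftrightarrow>
    (\<forall>f h. (\<forall>g\<in>G. \<exists>\<theta>\<in>\<Theta>. cinner f g = \<theta> * cinner h g) \<longrightarrow> (\<exists>\<theta>\<in>\<Theta>. f = \<theta> *\<^sub>C h))"

definition cross_ratio :: "complex \<Rightarrow> complex \<Rightarrow> complex \<Rightarrow> complex \<Rightarrow> complex" where
  "cross_ratio z1 z2 z3 z4 = ((z1 - z3) * (z2 - z4)) / ((z1 - z4) * (z2 - z3))"

end

theory Submission imports Defs begin

text \<open>
  Four distinct points are carried to four distinct points of the same cross ratio by a Moebius
  transformation \<open>\<mu>(z) = (a z + b) / (c z + d)\<close>. Substituting \<open>f' = d f - b h\<close> and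
  \<open>h' = a h - c f\<close> gives \<open>f' - z h' = (c z + d) (f - \<mu>(z) h)\<close>, so \<open>f = \<mu>(z) h\<close> is
  equivalent to \<open>f' = z h'\<close>, and likewise after pairing with any vector.
\<close>

lemma does_PR_moebius_image:
  fixes G :: "'a::complex_inner set"
  assumes PR: "does_PR \<Theta> G" and nz: "\<And>z. z \<in> \<Theta> \<Longrightarrow> c * z + d \<noteq> 0"
  shows "does_PR ((\<lambda>z. (a * z + b) / (c * z + d)) ` \<Theta>) G"
  unfolding does_PR_def
proof (intro allI impI)
  fix f h :: 'a
  assume *: "\<forall>g\<in>G. \<exists>w\<in>(\<lambda>z. (a * z + b) / (c * z + d)) ` \<Theta>. cinner f g = w * cinner h g"
  define f' where "f' = d *\<^sub>C f + (- b) *\<^sub>C h"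
  define h' where "h' = a *\<^sub>C h + (- c) *\<^sub>C f"
  have "\<exists>z\<in>\<Theta>. cinner f' g = z * cinner h' g" if g: "g \<in> G" for g
  proof -
    obtain z where z: "z \<in> \<Theta>" and "cinner f g = (a * z + b) / (c * z + d) * cinner h g"
      using * g by blast
    then have "(c * z + d) * cinner f g = (a * z + b) * cinner h g"
      using nz[OF z] by simp
    then have "cinner f' g = z * cinner h' g"
      unfolding f'_def h'_def cinner_add_left cinner_scaleC_left by algebra
    then show ?thesis using z by blast
  qed
  \<comment> \<open>The hypothesis, applied to the pair \<open>f'\<close>, \<open>h'\<close>,
    replaces the values of \<open>z\<close> that vary with \<open>g\<close> by a single one; undoing
    the substitution returns to \<open>f\<close> and \<open>h\<close>.\<close>
  then obtain z where z: "z \<in> \<Theta>" and eq: "f' = z *\<^sub>C h'"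
    using PR unfolding does_PR_def by blast
  have "d *\<^sub>C f + (- b) *\<^sub>C h = (z * a) *\<^sub>C h + (- (z * c)) *\<^sub>C f"
    using eq by (simp add: f'_def h'_def scaleC_scaleC complex_vector.scale_right_diff_distrib)
  then have "(c * z + d) *\<^sub>C f = (a * z + b) *\<^sub>C h"
    by (simp add: scaleC_add_left complex_vector.scale_minus_left algebra_simps)
  then have "inverse (c * z + d) *\<^sub>C (c * z + d) *\<^sub>C f =
      inverse (c * z + d) *\<^sub>C (a * z + b) *\<^sub>C h"
    by simp
  then have "f = ((a * z + b) / (c * z + d)) *\<^sub>C h"
    using nz[OF z] by (simp add: scaleC_scaleC scaleC_one divide_inverse mult.commute)
  then show "\<exists>w\<in>(\<lambda>z. (a * z + b) / (c * z + d)) ` \<Theta>. f = w *\<^sub>C h"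
    using z by blast
qed

text \<open>The images of \<open>z2\<close>, \<open>z3\<close>, \<open>z4\<close> determine a
  Moebius map, and it preserves cross ratios, so \<open>z1\<close> must go to
  \<open>w1\<close>.\<close>

lemma cross_ratio_eq_imp_moebius:
  assumes z: "distinct [z1, z2, z3, z4]" and w: "distinct [w1, w2, w3, w4]"
    and CR: "cross_ratio z1 z2 z3 z4 = cross_ratio w1 w2 w3 w4"
  obtains a b c d where "\<And>z. z \<in> {z1, z2, z3, z4} \<Longrightarrow> c * z + d \<noteq> 0"
    and "(\<lambda>z. (a * z + b) / (c * z + d)) ` {z1, z2, z3, z4} = {w1, w2, w3, w4}"
proof -
  text \<open>The coefficients come from solving
    \<open>cross_ratio z z2 z3 z4 = cross_ratio w w2 w3 w4\<close> for \<open>w\<close>.\<close>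
  define p where "p = (w2 - w4) * (z2 - z3)"
  define q where "q = (w2 - w3) * (z2 - z4)"
  define a where "a = p * w3 - q * w4"
  define b where "b = q * w4 * z3 - p * w3 * z4"
  define c where "c = p - q"
  define d where "d = q * z3 - p * z4"
  have "p \<noteq> 0" "q \<noteq> 0" using z w by (auto simp: p_def q_def)
  \<comment> \<open>The premise is the cross ratio equation with denominators cleared, so it also
    makes sense at \<open>z3\<close> and \<open>z4\<close>.\<close>
  have moebius: "c * z + d \<noteq> 0 \<and> (a * z + b) / (c * z + d) = w"
    if zw: "p * (z - z4) * (w - w3) = q * (z - z3) * (w - w4)" for z w
  proof -
    have num: "a * z + b = w * (c * z + d)"
      using zw unfolding a_def b_def c_def d_def by algebra
    have "c * z + d \<noteq> 0"
    proof
      assume "c * z + d = 0"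
      then have "p * (z - z4) = q * (z - z3)" "a * z + b = 0"
        using num unfolding c_def d_def by algebra+
      \<comment> \<open>Here \<open>a * z + b = p * (z - z4) * w3 - q * (z - z3) * w4\<close>, and
        the two coefficients agree. As \<open>w3\<close> and \<open>w4\<close> differ, both vanish,
        forcing \<open>z = z4\<close> and \<open>z = z3\<close>.\<close>
      then have "p * (z - z4) * (w3 - w4) = 0"
        unfolding a_def b_def by algebra
      with \<open>p * (z - z4) = q * (z - z3)\<close> show False
        using \<open>p \<noteq> 0\<close> \<open>q \<noteq> 0\<close> z w by auto
    qed
    then show ?thesis using num by simp
  qed
  have "(z1 - z3) * (z2 - z4) * ((w1 - w4) * (w2 - w3)) =
      (w1 - w3) * (w2 - w4) * ((z1 - z4) * (z2 - z3))"
    using CR z w by (simp add: cross_ratio_def frac_eq_eq)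
  then have m1: "c * z1 + d \<noteq> 0 \<and> (a * z1 + b) / (c * z1 + d) = w1"
    by (intro moebius) (simp add: p_def q_def mult_ac)
  \<comment> \<open>For the remaining pairs the premise is an identity: at \<open>z2\<close> by the
    choice of \<open>p\<close> and \<open>q\<close>, at \<open>z3\<close> and \<open>z4\<close>
    because both sides are 0.\<close>
  have m2: "c * z2 + d \<noteq> 0 \<and> (a * z2 + b) / (c * z2 + d) = w2"
    by (intro moebius) (simp add: p_def q_def mult_ac)
  have m3: "c * z3 + d \<noteq> 0 \<and> (a * z3 + b) / (c * z3 + d) = w3"
    by (intro moebius) simp
  have m4: "c * z4 + d \<noteq> 0 \<and> (a * z4 + b) / (c * z4 + d) = w4"
    by (intro moebius) simp
  show ?thesis
    using m1 m2 m3 m4 by (intro that[of c d a b]) auto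
qed

lemma does_PR_cross_ratio:
  assumes "does_PR {z1, z2, z3, z4} G"
    and "distinct [z1, z2, z3, z4]" and "distinct [w1, w2, w3, w4]"
    and "cross_ratio z1 z2 z3 z4 = cross_ratio w1 w2 w3 w4"
  shows "does_PR {w1, w2, w3, w4} G"
  using cross_ratio_eq_imp_moebius[OF assms(2-4)] does_PR_moebius_image[OF assms(1)] by metis

theorem corollary4p1:
  fixes G :: "'a::complex_hilbert_space set"
    and \<Theta> \<Theta>' :: "complex set"
  assumes "cdim TYPE('a) \<ge> 2"
    and "G \<noteq> {}"
    and "\<Theta> \<subseteq> sphere 0 1" and "\<Theta>' \<subseteq> sphere 0 1"
    and "card \<Theta> = 4" and "card \<Theta>' = 4"
    and "\<exists>\<theta>1 \<theta>2 \<theta>3 \<theta>4 \<theta>1' \<theta>2' \<theta>3' \<theta>4'.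
           \<Theta> = {\<theta>1, \<theta>2, \<theta>3, \<theta>4} \<and> \<Theta>' = {\<theta>1', \<theta>2', \<theta>3', \<theta>4'} \<and>
           cross_ratio \<theta>1 \<theta>2 \<theta>3 \<theta>4 = cross_ratio \<theta>1' \<theta>2' \<theta>3' \<theta>4'"
  shows "does_PR \<Theta> G \<longleftrightarrow> does_PR \<Theta>' G"
proof -
  obtain z1 z2 z3 z4 w1 w2 w3 w4 where eqs: "\<Theta> = {z1, z2, z3, z4}" "\<Theta>' = {w1, w2, w3, w4}"
    and CR: "cross_ratio z1 z2 z3 z4 = cross_ratio w1 w2 w3 w4"
    using assms(7) by blast
  \<comment> \<open>Cardinality 4 rules out repetitions in the enumerations.\<close>
  have "distinct [z1, z2, z3, z4]" "distinct [w1, w2, w3, w4]"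
    using assms(5,6) unfolding eqs by (auto simp: card_insert_if split: if_splits)
  \<comment> \<open>Equality of cross ratios is symmetric, so the one-way implication serves both
    directions.\<close>
  then show ?thesis
    using does_PR_cross_ratio CR unfolding eqs by metis
qed

end
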